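(* Let $\gamma_l,\gamma_r:\mathbb{R}\to\mathbb{R}$ be non-decreasing and Lipschitz continuous with $\gamma_r\le\gamma_l$, let $\mathcal{H}$ be the generalized play operator with hysteresis boundary curves $\gamma_l,\gamma_r$, and let $r:[0,\infty)\to\mathbb{R}$ be Lipschitz continuous. Let $u_0,w_0\in\mathbb{R}$ with $\gamma_r(u_0)\le w_0\le\gamma_l(u_0)$. Then for any $K>0$ the solution of the Cauchy problem $$\frac1K\frac{du}{dt}(t)+\mathcal{H}(u,w_0)(t)=r(t),\quad t\ge 0,\qquad u(0)=u_0,\quad \mathcal{H}(u,w_0)(0)=w_0,$$ exists and is unique.
   Context: Generalized play operator. Let $\gamma_l,\gamma_r:\mathbb{R}\to\mathbb{R}$ be continuous non-decreasing functions with $\gamma_r\le\gamma_l$. For a continuous piecewise linear function $u$ on $\mathbb{R}^+=[0,\infty)$, linear on each $[t_{i-1},t_i]$, $i=1,2,\dots$ (with $0=t_0<t_1<\cdots$), and $w_0\in\mathbb{R}$, define $w=\mathcal{H}(u,w_0):\mathbb{R}^+\to\mathbb{R}$ by $w(0)=\min\{\gamma_l(u(0)),\max\{\gamma_r(u(0)),w_0\}\}$ and $w(t)=\min\{\gamma_l(u(t)),\max\{\gamma_r(u(t)),w(t_{i-1})\}\}$ for $t\in(t_{i-1},t_i]$. It is assumed that $\gamma_r(u(0))\le w_0\le\gamma_l(u(0))$, so that $w(0)=w_0$. This operator has a unique continuous extension (with respect to uniform convergence on compact intervals) to $\mathcal{H}:C(\mathbb{R}^+)\times\mathbb{R}\to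 C(\mathbb{R}^+)$, called the generalized play operator with hysteresis boundary curves $\gamma_l,\gamma_r$. A solution of the Cauchy problem is a function $u$ on $[0,\infty)$, differentiable (one-sided at $0$), satisfying the equation for all $t\ge0$ and the initial conditions. *)

theory Defs
  imports "HOL-Analysis.Analysis"
begin

text \<open>
  Functions on \<open>[0,\<infinity>)\<close> are represented by functions of type \<^typ>\<open>real \<Rightarrow> real\<close> of which only
  the values on \<^term>\<open>{0::real..}\<close> matter.
\<close>

definition play_clip :: "(real \<Rightarrow> real) \<Rightarrow> (real \<Rightarrow> real) \<Rightarrow> real \<Rightarrow> real \<Rightarrow> real" where
  "play_clip gl gr x w = min (gl x) (max (gr x) w)"

text \<open>
  The breakpoints tend to infinity, so that the intervals \<open>[t i, t (i+1)]\<close> cover \<open>[0,\<infinity>)\<close>.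
\<close>

definition piecewise_linear_with :: "(nat \<Rightarrow> real) \<Rightarrow> (real \<Rightarrow> real) \<Rightarrow> bool" where
  "piecewise_linear_with t u \<longleftrightarrow>
     t 0 = 0 \<and> strict_mono t \<and> filterlim t at_top sequentially \<and>
     (\<forall>i. \<exists>a b. \<forall>s\<in>{t i..t (Suc i)}. u s = a * s + b)"

definition play_recursion ::
  "(real \<Rightarrow> real) \<Rightarrow> (real \<Rightarrow> real) \<Rightarrow> (nat \<Rightarrow> real) \<Rightarrow> (real \<Rightarrow> real) \<Rightarrow> real \<Rightarrow> (real \<Rightarrow> real) \<Rightarrow> bool"
  where
  "play_recursion gl gr t u w0 w \<longleftrightarrow>
     w 0 = play_clip gl gr (u 0) w0 \<and>
     (\<forall>i. \<forall>s\<in>{t i<..t (Suc i)}. w s = play_clip gl gr (u s) (w (t i)))"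

definition locally_uniform_limit :: "(nat \<Rightarrow> real \<Rightarrow> real) \<Rightarrow> (real \<Rightarrow> real) \<Rightarrow> bool" where
  "locally_uniform_limit us u \<longleftrightarrow> (\<forall>T\<ge>0. uniform_limit {0..T} us u sequentially)"

text \<open>
  A continuous extension of the piecewise linear operator to \<open>C([0,\<infinity>)) \<times> \<real>\<close>.
  The topology of uniform convergence on compact intervals is metrizable, so continuity
  is sequential continuity, here jointly in the input and the initial value.
\<close>

definition is_play_extension ::
  "(real \<Rightarrow> real) \<Rightarrow> (real \<Rightarrow> real) \<Rightarrow> ((real \<Rightarrow> real) \<Rightarrow> real \<Rightarrow> real \<Rightarrow> real) \<Rightarrow> bool" where
  "is_play_extension gl gr H \<longleftrightarrow>
     (\<forall>u w0. continuous_on {0..} u \<longrightarrow> continuous_on {0..} (H u w0)) \<and>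
     (\<forall>t u w0. piecewise_linear_with t u \<longrightarrow> play_recursion gl gr t u w0 (H u w0)) \<and>
     (\<forall>us u ws w0.
        (\<forall>n. continuous_on {0..} (us n)) \<and> continuous_on {0..} u \<and>
        locally_uniform_limit us u \<and> ws \<longlonglongrightarrow> w0 \<longrightarrow>
        locally_uniform_limit (\<lambda>n. H (us n) (ws n)) (H u w0))"

text \<open>
  For continuous non-decreasing \<open>gr \<le> gl\<close> such an extension exists, and density of the
  piecewise linear functions determines \<open>H u w0 t\<close> for all \<open>u\<close> continuous on \<open>[0,\<infinity>)\<close>
  and all \<open>t \<ge> 0\<close>. The choice operator only affects the remaining, irrelevant values.
\<close>

definition gen_play ::
  "(real \<Rightarrow> real) \<Rightarrow> (real \<Rightarrow> real) \<Rightarrow> (real \<Rightarrow> real) \<Rightarrow> real \<Rightarrow> real \<Rightarrow> real" where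
  "gen_play gl gr = (SOME H. is_play_extension gl gr H)"

text \<open>The derivative is one-sided at \<open>0\<close>, as it is taken within \<^term>\<open>{0::real..}\<close>.\<close>

definition play_cauchy_solution ::
  "(real \<Rightarrow> real) \<Rightarrow> (real \<Rightarrow> real) \<Rightarrow> (real \<Rightarrow> real) \<Rightarrow> real \<Rightarrow> real \<Rightarrow> real \<Rightarrow> (real \<Rightarrow> real) \<Rightarrow> bool"
  where
  "play_cauchy_solution gl gr r K u0 w0 u \<longleftrightarrow>
     (\<forall>t\<ge>0. \<exists>u'. (u has_real_derivative u') (at t within {0..}) \<and>
                 (1 / K) * u' + gen_play gl gr u w0 t = r t) \<and>
     u 0 = u0 \<and> gen_play gl gr u w0 0 = w0"

end

theory Submission imports Defs begin

text \<open>
  The play operator has a closed form. With the barriers \<open>L s = gl (u s)\<close> and \<open>R s = gr (u s)\<close>,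
  unfolding the recursion \<open>w\<^sub>n = min L\<^sub>n (max R\<^sub>n w\<^sub>n\<^sub>-\<^sub>1)\<close> suggests
  \<open>w(t) = max (min w\<^sub>0 (inf\<^bsub>[0,t]\<^esub> L)) (sup\<^bsub>s\<in>[0,t]\<^esub> min (R s) (inf\<^bsub>[s,t]\<^esub> L))\<close>,
  an expression that makes sense for every continuous input. For continuous barriers it is
  determined by the strict inequalities \<open>y < w(t)\<close>, which are first-order conditions on \<open>L\<close>,
  \<open>R\<close> and \<open>w\<^sub>0\<close> (lemma \<open>less_barrier_play_iff\<close>). From them follow the semigroup
  property in time, the clipping rule on intervals where the input is monotone, and the estimate
  that a perturbation of \<open>L\<close>, \<open>R\<close> and \<open>w\<^sub>0\<close> by at most \<open>d\<close> changes the
  output by at most \<open>d\<close>. Hence the formula is a continuous extension of the piecewise linear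
  operator (lemma \<open>play_is_play_extension\<close>), and because piecewise linear functions are dense,
  every continuous extension coincides with it (lemma \<open>is_play_extension_unique\<close>).

  For Lipschitz boundary curves the Cauchy problem thus reads \<open>u' = F u\<close>, where
  \<open>F u t = K * (r t - w(t))\<close> is causal and Lipschitz: \<open>F u t\<close> depends only on \<open>u\<close>
  on \<open>[0,t]\<close>, and \<open>\<bar>F u t - F v t\<bar> \<le> C * sup\<^bsub>[0,t]\<^esub> \<bar>u - v\<bar>\<close>. In the norm with
  weight \<open>exp (- 2 * C * t)\<close> the Picard operator contracts by the factor \<open>1/2\<close>
  (lemma \<open>weighted_contraction\<close>); this gives uniqueness, and existence as the limit of the
  Picard iterates.
\<close>

section \<open>The play between two barriers\<close>

text \<open>
  The output at time \<open>t\<close> of the play started at time \<open>a\<close> with the value \<open>w\<close>, between the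
  lower barrier \<open>R\<close> and the upper barrier \<open>L\<close>. It is meant for \<open>a \<le> t\<close> and continuous
  barriers. A general starting time makes the semigroup property expressible.
\<close>

definition barrier_play :: "(real \<Rightarrow> real) \<Rightarrow> (real \<Rightarrow> real) \<Rightarrow> real \<Rightarrow> real \<Rightarrow> real \<Rightarrow> real" where
  "barrier_play L R a w t =
     max (min w (INF \<tau>\<in>{a..t}. L \<tau>)) (SUP s\<in>{a..t}. min (R s) (INF \<tau>\<in>{s..t}. L \<tau>))"

lemma less_INF_compact_iff:
  fixes f :: "real \<Rightarrow> real"
  assumes "a \<le> t" "continuous_on {a..t} f"
  shows "y < (INF x\<in>{a..t}. f x) \<longleftrightarrow> (\<forall>x\<in>{a..t}. y < f x)"
proof -
  obtain m where m: "m \<in> {a..t}" "\<And>x. x \<in> {a..t} \<Longrightarrow> f m \<le> f x"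
    using continuous_attains_inf[OF compact_Icc _ assms(2)] assms(1) by auto
  have "(INF x\<in>{a..t}. f x) = f m"
    using m by (intro cInf_eq_minimum) auto
  with m show ?thesis by force
qed

text \<open>
  A real number is determined by the numbers strictly below it, so this characterisation reduces
  every property of the play to a statement about pointwise inequalities. Strict inequalities are
  the right ones: the infima are attained, and \<open>y\<close> is below a supremum iff it is below some
  member of the family.
\<close>

lemma less_barrier_play_iff:
  assumes "a \<le> t" and L: "continuous_on {a..t} L" and R: "continuous_on {a..t} R"
  shows "y < barrier_play L R a w t \<longleftrightarrow>
    (y < w \<and> (\<forall>\<tau>\<in>{a..t}. y < L \<tau>)) \<or> (\<exists>s\<in>{a..t}. y < R s \<and> (\<forall>\<tau>\<in>{s..t}. y < L \<tau>))"
proof -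
  have inf: "y < (INF \<tau>\<in>{s..t}. L \<tau>) \<longleftrightarrow> (\<forall>\<tau>\<in>{s..t}. y < L \<tau>)" if "s \<in> {a..t}" for s
    using that by (intro less_INF_compact_iff continuous_on_subset[OF L]) auto
  have "bdd_above (R ` {a..t})"
    by (intro bounded_imp_bdd_above compact_imp_bounded compact_continuous_image R compact_Icc)
  then have "bdd_above ((\<lambda>s. min (R s) (INF \<tau>\<in>{s..t}. L \<tau>)) ` {a..t})"
    unfolding bdd_above_def by (auto simp: min_le_iff_disj)
  then have "y < (SUP s\<in>{a..t}. min (R s) (INF \<tau>\<in>{s..t}. L \<tau>)) \<longleftrightarrow>
      (\<exists>s\<in>{a..t}. y < min (R s) (INF \<tau>\<in>{s..t}. L \<tau>))"
    using assms(1) by (intro less_cSUP_iff) auto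
  with inf assms(1) show ?thesis
    by (auto simp: barrier_play_def less_max_iff_disj)
qed

lemma eq_if_same_less:
  fixes x z :: real
  assumes "\<And>y. y < x \<longleftrightarrow> y < z"
  shows "x = z"
  using assms[of x] assms[of z] by simp

lemma barrier_play_at_start:
  "barrier_play L R a w a = max (min w (L a)) (min (R a) (L a))"
  by (simp add: barrier_play_def)

lemma barrier_play_semigroup:
  assumes "a \<le> s" "s \<le> t" and "continuous_on {a..t} L" "continuous_on {a..t} R"
  shows "barrier_play L R s (barrier_play L R a w s) t = barrier_play L R a w t"
proof (rule eq_if_same_less)
  fix y
  have c: "continuous_on {a..s} L" "continuous_on {a..s} R"
     "continuous_on {s..t} L" "continuous_on {s..t} R"
    using assms by (auto intro: continuous_on_subset)
  have split: "(\<forall>\<tau>\<in>{p..t}. y < L \<tau>) \<longleftrightarrow> (\<forall>\<tau>\<in>{p..s}. y < L \<tau>) \<and> (\<forall>\<tau>\<in>{s..t}. y < L \<tau>)" if "p \<le> s" for p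
  proof -
    have "{p..t} = {p..s} \<union> {s..t}" using that assms by auto
    then show ?thesis by (simp add: ball_Un)
  qed
  show "y < barrier_play L R s (barrier_play L R a w s) t \<longleftrightarrow> y < barrier_play L R a w t" (is "?l \<longleftrightarrow> ?r")
  proof -
    have "?r \<longleftrightarrow> (y < w \<and> (\<forall>\<tau>\<in>{a..t}. y < L \<tau>)) \<or> (\<exists>p\<in>{a..s}. y < R p \<and> (\<forall>\<tau>\<in>{p..t}. y < L \<tau>))
       \<or> (\<exists>p\<in>{s..t}. y < R p \<and> (\<forall>\<tau>\<in>{p..t}. y < L \<tau>))"
    proof -
      have "{a..t} = {a..s} \<union> {s..t}" using assms by auto
      then show ?thesis
        using assms by (subst less_barrier_play_iff) (auto simp: bex_Un)
    qed
    also have "\<dots> \<longleftrightarrow> ?l"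
      unfolding less_barrier_play_iff[OF assms(2) c(3,4)] less_barrier_play_iff[OF assms(1) c(1,2)]
      using split assms(1) by (meson atLeastAtMost_iff)
    finally show ?thesis by blast
  qed
qed

lemma barrier_play_between:
  assumes "a \<le> t" "continuous_on {a..t} L" "continuous_on {a..t} R" "R t \<le> L t"
  shows "R t \<le> barrier_play L R a w t" "barrier_play L R a w t \<le> L t"
proof -
  show "R t \<le> barrier_play L R a w t"
  proof (rule dense_le)
    fix y assume "y < R t"
    with assms have "\<exists>s\<in>{a..t}. y < R s \<and> (\<forall>\<tau>\<in>{s..t}. y < L \<tau>)"
      by (intro bexI[of _ t]) auto
    then show "y \<le> barrier_play L R a w t"
      using less_barrier_play_iff[OF assms(1-3)] by (blast intro: less_imp_le)
  qed
  show "barrier_play L R a w t \<le> L t"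
  proof (rule dense_le)
    fix y assume "y < barrier_play L R a w t"
    then have "y < L t"
      unfolding less_barrier_play_iff[OF assms(1-3)] using assms(1) by auto
    then show "y \<le> L t" by simp
  qed
qed

text \<open>
  The play is monotone in both barriers and in the initial value, and commutes with the addition of
  constants; hence it is non-expansive.
\<close>

lemma barrier_play_le_shift:
  assumes "a \<le> t"
    and "continuous_on {a..t} L" "continuous_on {a..t} R"
    and "continuous_on {a..t} L'" "continuous_on {a..t} R'"
    and "\<And>s. s \<in> {a..t} \<Longrightarrow> L s \<le> L' s + d" "\<And>s. s \<in> {a..t} \<Longrightarrow> R s \<le> R' s + d" "w \<le> w' + d"
  shows "barrier_play L R a w t \<le> barrier_play L' R' a w' t + d"
proof (rule dense_le)
  fix y assume "y < barrier_play L R a w t"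
  then have y: "(y < w \<and> (\<forall>\<tau>\<in>{a..t}. y < L \<tau>)) \<or> (\<exists>s\<in>{a..t}. y < R s \<and> (\<forall>\<tau>\<in>{s..t}. y < L \<tau>))"
    using assms by (simp add: less_barrier_play_iff)
  have l: "y - d < L' s" if "y < L s" "s \<in> {a..t}" for s using assms(6)[of s] that by linarith
  have r: "y - d < R' s" if "y < R s" "s \<in> {a..t}" for s using assms(7)[of s] that by linarith
  have w: "y - d < w'" if "y < w" using assms(8) that by linarith
  from y have "y - d < barrier_play L' R' a w' t"
    unfolding less_barrier_play_iff[OF assms(1,4,5)]
  proof (elim disjE bexE conjE)
    assume "y < w" "\<forall>\<tau>\<in>{a..t}. y < L \<tau>"
    then show "(y - d < w' \<and> (\<forall>\<tau>\<in>{a..t}. y - d < L' \<tau>)) \<or> (\<exists>s\<in>{a..t}. y - d < R' s \<and> (\<forall>\<tau>\<in>{s..t}. y - d < L' \<tau>))"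
      using l w by blast
  next
    fix s assume s: "s \<in> {a..t}" "y < R s" "\<forall>\<tau>\<in>{s..t}. y < L \<tau>"
    then have "\<forall>\<tau>\<in>{s..t}. y - d < L' \<tau>" using l by auto
    with s r show "(y - d < w' \<and> (\<forall>\<tau>\<in>{a..t}. y - d < L' \<tau>)) \<or> (\<exists>s\<in>{a..t}. y - d < R' s \<and> (\<forall>\<tau>\<in>{s..t}. y - d < L' \<tau>))"
      by blast
  qed
  then show "y \<le> barrier_play L' R' a w' t + d" by simp
qed

lemma barrier_play_dist_le:
  assumes "a \<le> t"
    and "continuous_on {a..t} L" "continuous_on {a..t} R"
    and "continuous_on {a..t} L'" "continuous_on {a..t} R'"
    and "\<And>s. s \<in> {a..t} \<Longrightarrow> \<bar>L s - L' s\<bar> \<le> d" "\<And>s. s \<in> {a..t} \<Longrightarrow> \<bar>R s - R' s\<bar> \<le> d" "\<bar>w - w'\<bar> \<le> d"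
  shows "\<bar>barrier_play L R a w t - barrier_play L' R' a w' t\<bar> \<le> d"
proof -
  have "barrier_play L R a w t \<le> barrier_play L' R' a w' t + d"
    using assms(6-8) by (intro barrier_play_le_shift assms) (fastforce simp: abs_le_iff)+
  moreover have "barrier_play L' R' a w' t \<le> barrier_play L R a w t + d"
    using assms(6-8) by (intro barrier_play_le_shift assms) (fastforce simp: abs_le_iff)+
  ultimately show ?thesis by linarith
qed

text \<open>
  An output that starts between the barriers moves no more than they do; with the semigroup property
  this yields continuity in time.
\<close>

lemma barrier_play_increment_le:
  assumes "a \<le> t" "continuous_on {a..t} L" "continuous_on {a..t} R" "R a \<le> w" "w \<le> L a"
    and L: "\<And>s. s \<in> {a..t} \<Longrightarrow> \<bar>L s - L a\<bar> \<le> d" and R: "\<And>s. s \<in> {a..t} \<Longrightarrow> \<bar>R s - R a\<bar> \<le> d"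
  shows "\<bar>barrier_play L R a w t - w\<bar> \<le> d"
proof -
  have d: "0 \<le> d" using L[of a] assms(1) by auto
  have "barrier_play L R a w t \<le> w + d"
  proof (rule dense_le)
    fix y assume "y < barrier_play L R a w t"
    then consider "y < w" | s where "s \<in> {a..t}" "y < R s"
      using assms by (auto simp: less_barrier_play_iff)
    then show "y \<le> w + d"
      using d R assms(4) by cases fastforce+
  qed
  moreover have "w - d \<le> barrier_play L R a w t"
  proof (rule dense_le)
    fix y assume y: "y < w - d"
    then have "y < L s" if "s \<in> {a..t}" for s using L[OF that] assms(5) by linarith
    with y d have "y < barrier_play L R a w t"
      using assms by (simp add: less_barrier_play_iff)
    then show "y \<le> barrier_play L R a w t" by simp
  qed
  ultimately show ?thesis by linarith
qed

text \<open>
  When both barriers move in the same direction and \<open>w\<close> lies between their initial values, only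
  their final values matter. This is the clipping rule on an interval where the input is linear.
\<close>

lemma barrier_play_mono_barriers:
  assumes "a \<le> t" "continuous_on {a..t} L" "continuous_on {a..t} R" "w \<le> L a" "R t \<le> L t"
    and L: "mono_on {a..t} L" and R: "mono_on {a..t} R"
  shows "barrier_play L R a w t = min (L t) (max (R t) w)"
proof (rule eq_if_same_less)
  fix y
  have "w \<le> L s" if "s \<in> {a..t}" for s
    using mono_onD[OF L, of a s] that assms by auto
  moreover have "R s \<le> R t" if "s \<in> {a..t}" for s
    using mono_onD[OF R, of s t] that assms by auto
  ultimately show "y < barrier_play L R a w t \<longleftrightarrow> y < min (L t) (max (R t) w)"
    using assms unfolding less_barrier_play_iff[OF assms(1-3)] less_max_iff_disj min_less_iff_conj
    by (fastforce simp: less_max_iff_disj intro: bexI[of _ t])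
qed

lemma barrier_play_antimono_barriers:
  assumes "a \<le> t" "continuous_on {a..t} L" "continuous_on {a..t} R" "R a \<le> w" 
    and L: "antimono_on {a..t} L" and R: "antimono_on {a..t} R"
  shows "barrier_play L R a w t = min (L t) (max (R t) w)"
proof (rule eq_if_same_less)
  fix y
  have L': "L t \<le> L s" if "s \<in> {a..t}" for s
    using monotone_onD[OF L, of s t] that assms by auto
  have R': "R s \<le> w" if "s \<in> {a..t}" for s
    using monotone_onD[OF R, of a s] that assms by auto
  have *: "(\<forall>\<tau>\<in>{s..t}. y < L \<tau>) \<longleftrightarrow> y < L t" if "s \<in> {a..t}" for s
  proof
    assume "\<forall>\<tau>\<in>{s..t}. y < L \<tau>"
    then show "y < L t" using that by auto
  next
    assume y: "y < L t"
    show "\<forall>\<tau>\<in>{s..t}. y < L \<tau>"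
    proof
      fix \<tau> assume "\<tau> \<in> {s..t}"
      then have "L t \<le> L \<tau>" using that by (intro L') auto
      with y show "y < L \<tau>" by linarith
    qed
  qed
  have "y < barrier_play L R a w t \<longleftrightarrow> (y < w \<and> y < L t) \<or> (\<exists>s\<in>{a..t}. y < R s \<and> y < L t)"
    unfolding less_barrier_play_iff[OF assms(1-3)] using * assms(1) by auto
  also have "\<dots> \<longleftrightarrow> y < w \<and> y < L t" using R' by fastforce
  also have "\<dots> \<longleftrightarrow> y < min (L t) (max (R t) w)"
    using R'[of t] assms(1) by auto
  finally show "y < barrier_play L R a w t \<longleftrightarrow> y < min (L t) (max (R t) w)" .
qed

section \<open>Continuous and piecewise linear functions on the half-line\<close>

lemma continuous_on_Icc_bounded:
  fixes f :: "real \<Rightarrow> real"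
  assumes "continuous_on {a..b} f"
  obtains M where "\<And>x. x \<in> {a..b} \<Longrightarrow> \<bar>f x\<bar> \<le> M"
proof -
  have "bounded (f ` {a..b})"
    using assms by (intro compact_imp_bounded compact_continuous_image) auto
  then obtain M where "\<forall>y\<in>f ` {a..b}. norm y \<le> M" unfolding bounded_iff by blast
  then show thesis by (intro that[of M]) auto
qed

lemma continuous_on_atLeast_0I:
  fixes u :: "real \<Rightarrow> real"
  assumes "\<And>T. 0 \<le> T \<Longrightarrow> continuous_on {0..T} u"
  shows "continuous_on {0..} u"
  unfolding continuous_on_eq_continuous_within
proof
  fix x :: real assume x: "x \<in> {0..}"
  have "continuous (at x within {0..x + 1}) u"
    using assms[of "x + 1"] x by (auto simp: continuous_on_eq_continuous_within)
  moreover have "at x within {0..x + 1} = at x within {0..}"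
    by (intro at_within_nhd[where S = "{..<x + 1}"]) auto
  ultimately show "continuous (at x within {0..}) u" by simp
qed

lemma uniform_limit_compose_continuous:
  fixes g u :: "real \<Rightarrow> real" and T :: real
  assumes g: "continuous_on UNIV g" and u: "continuous_on {0..T} u"
    and lim: "uniform_limit {0..T} us u sequentially"
  shows "uniform_limit {0..T} (\<lambda>n s. g (us n s)) (\<lambda>s. g (u s)) sequentially"
proof -
  obtain b where b: "\<And>s. s \<in> {0..T} \<Longrightarrow> \<bar>u s\<bar> \<le> b"
    using continuous_on_Icc_bounded[OF u] by blast
  show ?thesis
  proof (rule uniform_limit_compose_uniformly_continuous_on[OF lim])
    show "uniformly_continuous_on {-(b+1)..b+1} g"
      by (intro compact_uniformly_continuous continuous_on_subset[OF g]) auto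
    show "\<forall>\<^sub>F n in sequentially. \<forall>s\<in>{0..T}. us n s \<in> {-(b+1)..b+1}"
      using uniform_limitD[OF lim zero_less_one]
    proof eventually_elim
      case (elim n)
      show ?case
      proof
        fix s assume "s \<in> {0..T}"
        with elim b show "us n s \<in> {-(b+1)..b+1}" by (force simp: dist_real_def)
      qed
    qed
  qed auto
qed

lemma piecewise_linear_covers:
  assumes "piecewise_linear_with t u"
  shows "\<exists>i. x \<le> t i"
  using assms unfolding piecewise_linear_with_def filterlim_at_top eventually_sequentially
  by blast

lemma piecewise_linear_nonneg:
  assumes "piecewise_linear_with t u"
  shows "0 \<le> t i" "t i < t (Suc i)"
  using assms strict_mono_less_eq[of t 0 i] strict_mono_less[of t i "Suc i"]
  by (auto simp: piecewise_linear_with_def)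

lemma piecewise_linear_continuous:
  assumes "piecewise_linear_with t u"
  shows "continuous_on {0..} u"
proof -
  have Icc: "continuous_on {0..t i} u" for i
  proof (induction i)
    case 0
    then show ?case using assms by (simp add: piecewise_linear_with_def)
  next
    case (Suc i)
    obtain a b where "\<forall>s\<in>{t i..t (Suc i)}. u s = a * s + b"
      using assms unfolding piecewise_linear_with_def by blast
    then have "continuous_on {t i..t (Suc i)} u \<longleftrightarrow> continuous_on {t i..t (Suc i)} (\<lambda>s. a * s + b)"
      by (intro continuous_on_cong) auto
    then have "continuous_on {t i..t (Suc i)} u" by (simp add: continuous_intros)
    moreover have "{0..t (Suc i)} = {0..t i} \<union> {t i..t (Suc i)}"
      using piecewise_linear_nonneg[OF assms, of i] by auto
    ultimately show ?case using Suc by (auto intro: continuous_on_closed_Un)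
  qed
  show ?thesis
  proof (rule continuous_on_atLeast_0I)
    fix T :: real
    obtain i where "T \<le> t i" using piecewise_linear_covers[OF assms] by blast
    then show "continuous_on {0..T} u" by (intro continuous_on_subset[OF Icc[of i]]) auto
  qed
qed

text \<open>
  The linear interpolant of \<open>u\<close> at the nodes \<open>i / N\<close>: on \<open>[i / N, (i + 1) / N)\<close> the
  floor of \<open>N * x\<close> is \<open>i\<close>, and the formula is also correct at the right end point, where
  the floor jumps.
\<close>

lemma piecewise_linear_interpolation:
  fixes u :: "real \<Rightarrow> real" and N :: real
  assumes N: "0 < N"
  defines "v \<equiv> \<lambda>x. u (\<lfloor>N * x\<rfloor> / N) + (N * x - \<lfloor>N * x\<rfloor>) * (u ((\<lfloor>N * x\<rfloor> + 1) / N) - u (\<lfloor>N * x\<rfloor> / N))"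
  shows "piecewise_linear_with (\<lambda>i. real i / N) v"
  unfolding piecewise_linear_with_def
proof (intro conjI allI)
  show "strict_mono (\<lambda>i. real i / N)"
    using N by (auto intro!: strict_monoI divide_strict_right_mono)
  show "filterlim (\<lambda>i. real i / N) at_top sequentially"
    using N by (auto simp: divide_inverse intro!: filterlim_at_top_mult_tendsto_pos[OF tendsto_const] filterlim_real_sequentially)
  fix i
  define a where "a = N * (u ((real i + 1) / N) - u (real i / N))"
  have "v s = a * s + (u (real i / N) - a * (real i / N))" if s: "s \<in> {real i / N..real (Suc i) / N}" for s
  proof (cases "s = real (Suc i) / N")
    case True
    then have "N * s = real_of_int (int (Suc i))" using N by simp
    then have "\<lfloor>N * s\<rfloor> = int (Suc i)" by (simp only: floor_of_int)
    with True N have "v s = u ((real i + 1) / N)" by (simp add: v_def add.commute)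
    moreover have "s = real i / N + 1 / N" using True by (simp add: add_divide_distrib)
    then have "a * s - a * (real i / N) = u ((real i + 1) / N) - u (real i / N)"
      using N by (simp add: a_def distrib_left)
    ultimately show ?thesis by simp
  next
    case False
    with s have s': "real i \<le> N * s" "N * s < real i + 1"
      using N by (auto simp: field_simps)
    then have "\<lfloor>N * s\<rfloor> = int i" by (intro floor_unique) auto
    with N show ?thesis by (simp add: v_def a_def field_simps)
  qed
  then show "\<exists>a b. \<forall>s\<in>{real i / N..real (Suc i) / N}. v s = a * s + b" by blast
qed simp

lemma piecewise_linear_dense:
  assumes u: "continuous_on {0..} u"
  obtains us ts where "\<And>n. piecewise_linear_with (ts n) (us n)" "locally_uniform_limit us u"
proof
  define N where "N n = real (Suc n)" for n
  define us where "us n x = u (\<lfloor>N n * x\<rfloor> / N n) +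
    (N n * x - \<lfloor>N n * x\<rfloor>) * (u ((\<lfloor>N n * x\<rfloor> + 1) / N n) - u (\<lfloor>N n * x\<rfloor> / N n))" for n x
  show "piecewise_linear_with (\<lambda>i. real i / N n) (us n)" for n
    unfolding us_def by (rule piecewise_linear_interpolation) (simp add: N_def)
  show "locally_uniform_limit us u"
    unfolding locally_uniform_limit_def
  proof (intro allI impI uniform_limitI)
    fix T e :: real assume T: "0 \<le> T" and e: "0 < e"
    have "uniformly_continuous_on {0..T+1} u"
      by (intro compact_uniformly_continuous continuous_on_subset[OF u]) auto
    then obtain d where d: "d > 0"
      "\<And>x y. x \<in> {0..T+1} \<Longrightarrow> y \<in> {0..T+1} \<Longrightarrow> dist y x < d \<Longrightarrow> dist (u y) (u x) < e"
      using e unfolding uniformly_continuous_on_def by metis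
    have "\<forall>\<^sub>F n in sequentially. inverse (real (Suc n)) < d"
      using order_tendstoD(2)[OF LIMSEQ_inverse_real_of_nat d(1)] .
    then show "\<forall>\<^sub>F n in sequentially. \<forall>x\<in>{0..T}. dist (us n x) (u x) < e"
    proof eventually_elim
      case (elim n)
      show ?case
      proof
        fix x assume x: "x \<in> {0..T}"
        have N: "N n \<ge> 1" by (simp add: N_def)
        define \<theta> where "\<theta> = N n * x - \<lfloor>N n * x\<rfloor>"
        define p where "p = \<lfloor>N n * x\<rfloor> / N n"
        define q where "q = (\<lfloor>N n * x\<rfloor> + 1) / N n"
        have \<theta>: "0 \<le> \<theta>" "\<theta> \<le> 1" unfolding \<theta>_def by linarith+
        have Nd: "1 / N n < d" "1 / N n \<le> 1" using elim N by (simp_all add: N_def field_simps)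
        have xp: "x - p = \<theta> / N n" and qx: "q - x = (1 - \<theta>) / N n"
          using N by (simp_all add: p_def q_def \<theta>_def field_simps)
        have "\<theta> / N n \<le> 1 / N n" "(1 - \<theta>) / N n \<le> 1 / N n" "0 \<le> \<theta> / N n" "0 \<le> (1 - \<theta>) / N n"
          using \<theta> N by (auto intro: divide_right_mono)
        with xp qx Nd have "\<bar>p - x\<bar> < d" "\<bar>q - x\<bar> < d" "p \<le> x" "x \<le> q" "q \<le> x + 1" by linarith+
        moreover have "0 \<le> p" using x N by (simp add: p_def)
        ultimately have pq: "\<bar>u p - u x\<bar> < e" "\<bar>u q - u x\<bar> < e"
          using d(2)[of x p] d(2)[of x q] x by (auto simp: dist_real_def)
        \<comment> \<open>The error is a convex combination of the errors at the two neighbouring nodes.\<close>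
        have "us n x - u x = (1 - \<theta>) *\<^sub>R (u p - u x) + \<theta> *\<^sub>R (u q - u x)"
          by (simp add: us_def \<theta>_def p_def q_def algebra_simps)
        also have "\<dots> \<in> ball 0 e"
          using pq \<theta> by (intro convexD[OF convex_ball]) (auto simp: dist_real_def)
        finally show "dist (us n x) (u x) < e" by (simp add: dist_real_def)
      qed
    qed
  qed
qed

section \<open>The closed form as an extension of the play recursion\<close>

text \<open>
  The closed form of the generalized play operator, for inputs \<open>u\<close> continuous on \<open>[0,\<infinity>)\<close>
  and times \<open>t \<ge> 0\<close>.
\<close>

definition play :: "(real \<Rightarrow> real) \<Rightarrow> (real \<Rightarrow> real) \<Rightarrow> (real \<Rightarrow> real) \<Rightarrow> real \<Rightarrow> real \<Rightarrow> real" where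
  "play gl gr u w t = barrier_play (\<lambda>s. gl (u s)) (\<lambda>s. gr (u s)) 0 w t"

text \<open>
  Continuous non-decreasing hysteresis boundary curves: the left curve \<open>gl\<close> bounds the output from above, the right curve
  \<open>gr\<close> bounds it from below.
\<close>

locale hysteresis_curves =
  fixes gl gr :: "real \<Rightarrow> real"
  assumes mono_gl: "mono gl" and mono_gr: "mono gr"
    and cont_gl: "continuous_on UNIV gl" and cont_gr: "continuous_on UNIV gr"
    and le: "gr x \<le> gl x"
begin

lemma continuous_on_curves:
  assumes "continuous_on {0..} u" "A \<subseteq> {0..}"
  shows "continuous_on A (\<lambda>s. gl (u s))" "continuous_on A (\<lambda>s. gr (u s))"
  using continuous_on_compose2[OF cont_gl continuous_on_subset[OF assms]]
    continuous_on_compose2[OF cont_gr continuous_on_subset[OF assms]] by auto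

lemma play_between:
  assumes "continuous_on {0..} u" "0 \<le> t"
  shows "gr (u t) \<le> play gl gr u w t" "play gl gr u w t \<le> gl (u t)"
proof -
  have "continuous_on {0..t} (\<lambda>s. gl (u s))" "continuous_on {0..t} (\<lambda>s. gr (u s))"
    by (auto intro!: continuous_on_curves assms(1))
  from barrier_play_between[where L = "\<lambda>s. gl (u s)" and R = "\<lambda>s. gr (u s)" and w = w,
      OF assms(2) this le]
  show "gr (u t) \<le> play gl gr u w t" "play gl gr u w t \<le> gl (u t)"
    by (simp_all add: play_def)
qed

lemma play_semigroup:
  assumes "continuous_on {0..} u" "0 \<le> s" "s \<le> t"
  shows "play gl gr u w t = barrier_play (\<lambda>s. gl (u s)) (\<lambda>s. gr (u s)) s (play gl gr u w s) t"
  unfolding play_def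
  by (rule barrier_play_semigroup[symmetric])
    (auto intro!: continuous_on_curves assms)

lemma play_at_0:
  "play gl gr u w 0 = play_clip gl gr (u 0) w"
  using le[of "u 0"] by (auto simp: play_def play_clip_def barrier_play_at_start)

lemma play_dist_le:
  assumes "continuous_on {0..} u" "continuous_on {0..} v" "0 \<le> t"
    and "\<And>s. s \<in> {0..t} \<Longrightarrow> \<bar>gl (u s) - gl (v s)\<bar> \<le> d"
    and "\<And>s. s \<in> {0..t} \<Longrightarrow> \<bar>gr (u s) - gr (v s)\<bar> \<le> d"
    and "\<bar>w - w'\<bar> \<le> d"
  shows "\<bar>play gl gr u w t - play gl gr v w' t\<bar> \<le> d"
  unfolding play_def using assms
  by (intro barrier_play_dist_le continuous_on_curves) auto

lemma play_continuous:
  assumes u: "continuous_on {0..} u"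
  shows "continuous_on {0..} (play gl gr u w)"
proof (rule continuous_on_atLeast_0I)
  fix T :: real assume T: "0 \<le> T"
  have uc: "uniformly_continuous_on {0..T} (\<lambda>s. gl (u s))" "uniformly_continuous_on {0..T} (\<lambda>s. gr (u s))"
    by (auto intro!: compact_uniformly_continuous continuous_on_curves u)
  show "continuous_on {0..T} (play gl gr u w)"
  proof (rule uniformly_continuous_imp_continuous, unfold uniformly_continuous_on_def, intro allI impI)
    fix e :: real assume e: "0 < e"
    obtain d1 where d1: "d1 > 0" "\<And>x y. x \<in> {0..T} \<Longrightarrow> y \<in> {0..T} \<Longrightarrow> dist y x < d1 \<Longrightarrow> dist (gl (u y)) (gl (u x)) < e / 2"
      using uc(1) e unfolding uniformly_continuous_on_def by (meson half_gt_zero)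
    obtain d2 where d2: "d2 > 0" "\<And>x y. x \<in> {0..T} \<Longrightarrow> y \<in> {0..T} \<Longrightarrow> dist y x < d2 \<Longrightarrow> dist (gr (u y)) (gr (u x)) < e / 2"
      using uc(2) e unfolding uniformly_continuous_on_def by (meson half_gt_zero)
    \<comment> \<open>The barriers vary by at most \<open>e / 2\<close> over short times, hence so does the output.\<close>
    have main: "dist (play gl gr u w t) (play gl gr u w s) < e"
      if "0 \<le> s" "s \<le> t" "t \<le> T" "t - s < min d1 d2" for s t
    proof -
      have "\<bar>barrier_play (\<lambda>s. gl (u s)) (\<lambda>s. gr (u s)) s (play gl gr u w s) t - play gl gr u w s\<bar> \<le> e / 2"
      proof (rule barrier_play_increment_le)
        show "gr (u s) \<le> play gl gr u w s" "play gl gr u w s \<le> gl (u s)"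
          using play_between[OF u that(1)] by auto
        fix x assume "x \<in> {s..t}"
        then have "x \<in> {0..T}" "s \<in> {0..T}" "dist x s < d1" "dist x s < d2"
          using that by (auto simp: dist_real_def)
        then show "\<bar>gl (u x) - gl (u s)\<bar> \<le> e / 2" "\<bar>gr (u x) - gr (u s)\<bar> \<le> e / 2"
          using d1(2)[of s x] d2(2)[of s x] by (auto simp: dist_real_def)
      qed (use that in \<open>auto intro!: continuous_on_curves u\<close>)
      then show ?thesis
        using play_semigroup[OF u that(1,2), of w] e by (simp add: dist_real_def)
    qed
    show "\<exists>d>0. \<forall>x\<in>{0..T}. \<forall>x'\<in>{0..T}. dist x' x < d \<longrightarrow> dist (play gl gr u w x') (play gl gr u w x) < e"
    proof (intro exI[of _ "min d1 d2"] conjI ballI impI)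
      fix x x' assume x: "x \<in> {0..T}" "x' \<in> {0..T}" "dist x' x < min d1 d2"
      show "dist (play gl gr u w x') (play gl gr u w x) < e"
      proof (cases "x \<le> x'")
        case True
        then show ?thesis using main[of x x'] x by (auto simp: dist_real_def)
      next
        case False
        then show ?thesis using main[of x' x] x by (subst dist_commute) (auto simp: dist_real_def)
      qed
    qed (use d1 d2 in auto)
  qed
qed

lemma play_satisfies_recursion:
  assumes pl: "piecewise_linear_with t u"
  shows "play_recursion gl gr t u w (play gl gr u w)"
  unfolding play_recursion_def
proof (intro conjI allI ballI play_at_0)
  fix i s assume s: "s \<in> {t i<..t (Suc i)}"
  have u: "continuous_on {0..} u" by (rule piecewise_linear_continuous[OF pl])
  have ti: "0 \<le> t i" by (rule piecewise_linear_nonneg[OF pl])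
  obtain a b where ab: "\<forall>s\<in>{t i..t (Suc i)}. u s = a * s + b"
    using pl unfolding piecewise_linear_with_def by blast
  let ?w = "play gl gr u w (t i)"
  have "barrier_play (\<lambda>s. gl (u s)) (\<lambda>s. gr (u s)) (t i) ?w s = min (gl (u s)) (max (gr (u s)) ?w)"
  proof (cases "0 \<le> a")
    case True
    have "u x \<le> u y" if "x \<in> {t i..s}" "y \<in> {t i..s}" "x \<le> y" for x y
      using that s ab True by (auto intro: mult_left_mono)
    then have "mono_on {t i..s} (\<lambda>s. gl (u s))" "mono_on {t i..s} (\<lambda>s. gr (u s))"
      by (auto intro!: mono_onI monoD[OF mono_gl] monoD[OF mono_gr])
    then show ?thesis
      using s ti le play_between[OF u ti]
      by (intro barrier_play_mono_barriers continuous_on_curves u) auto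
  next
    case False
    have "u y \<le> u x" if "x \<in> {t i..s}" "y \<in> {t i..s}" "x \<le> y" for x y
      using that s ab False by (auto intro: mult_left_mono_neg)
    then have "antimono_on {t i..s} (\<lambda>s. gl (u s))" "antimono_on {t i..s} (\<lambda>s. gr (u s))"
      by (auto intro!: monotone_onI monoD[OF mono_gl] monoD[OF mono_gr])
    then show ?thesis
      using s ti le play_between[OF u ti]
      by (intro barrier_play_antimono_barriers continuous_on_curves u) auto
  qed
  then show "play gl gr u w s = play_clip gl gr (u s) (play gl gr u w (t i))"
    using play_semigroup[OF u ti, of s w] s by (simp add: play_clip_def)
qed

lemma play_locally_uniform_limit:
  assumes us: "\<And>n. continuous_on {0..} (us n)" and u: "continuous_on {0..} u"
    and lim: "locally_uniform_limit us u" and ws: "ws \<longlonglongrightarrow> w"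
  shows "locally_uniform_limit (\<lambda>n. play gl gr (us n) (ws n)) (play gl gr u w)"
  unfolding locally_uniform_limit_def
proof (intro allI impI uniform_limitI)
  fix T e :: real assume T: "0 \<le> T" and e: "0 < e"
  have uT: "continuous_on {0..T} u" by (rule continuous_on_subset[OF u]) auto
  have limT: "uniform_limit {0..T} us u sequentially"
    using lim T by (simp add: locally_uniform_limit_def)
  note gl = uniform_limitD[OF uniform_limit_compose_continuous[OF cont_gl uT limT], of "e/2"]
  note gr = uniform_limitD[OF uniform_limit_compose_continuous[OF cont_gr uT limT], of "e/2"]
  have "\<forall>\<^sub>F n in sequentially. dist (ws n) w < e/2" using ws e by (intro tendstoD) auto
  then show "\<forall>\<^sub>F n in sequentially. \<forall>t\<in>{0..T}. dist (play gl gr (us n) (ws n) t) (play gl gr u w t) < e"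
    using gl[OF half_gt_zero[OF e]] gr[OF half_gt_zero[OF e]]
  proof eventually_elim
    case (elim n)
    show ?case
    proof
      fix t assume t: "t \<in> {0..T}"
      have "\<bar>play gl gr (us n) (ws n) t - play gl gr u w t\<bar> \<le> e/2"
        using elim t by (intro play_dist_le us u) (auto simp: dist_real_def less_imp_le)
      then show "dist (play gl gr (us n) (ws n) t) (play gl gr u w t) < e"
        using e by (simp add: dist_real_def)
    qed
  qed
qed

lemma play_is_play_extension: "is_play_extension gl gr (play gl gr)"
  unfolding is_play_extension_def
  by (blast intro: play_continuous play_satisfies_recursion play_locally_uniform_limit)

end

section \<open>Uniqueness of the extension\<close>

lemma play_recursion_unique:
  assumes pl: "piecewise_linear_with t u"
    and "play_recursion gl gr t u w0 w" "play_recursion gl gr t u w0 w'"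
    and "0 \<le> x"
  shows "w x = w' x"
proof -
  have "\<forall>x\<in>{0..t i}. w x = w' x" for i
  proof (induction i)
    case 0
    then show ?case using assms by (auto simp: piecewise_linear_with_def play_recursion_def)
  next
    case (Suc i)
    show ?case
    proof
      fix x assume x: "x \<in> {0..t (Suc i)}"
      have "w (t i) = w' (t i)" using Suc piecewise_linear_nonneg[OF pl, of i] by auto
      then show "w x = w' x"
      proof (cases "x \<le> t i")
        case True
        with Suc x show ?thesis by auto
      next
        case False
        with x have "x \<in> {t i<..t (Suc i)}" by auto
        with assms(2,3) \<open>w (t i) = w' (t i)\<close> show ?thesis
          unfolding play_recursion_def by metis
      qed
    qed
  qed
  then show ?thesis using piecewise_linear_covers[OF pl, of x] assms(4) by auto
qed

lemma is_play_extension_unique: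
  assumes H: "is_play_extension gl gr H" and H': "is_play_extension gl gr H'"
    and u: "continuous_on {0..} u" and x: "0 \<le> x"
  shows "H u w x = H' u w x"
proof -
  obtain us ts where us: "\<And>n. piecewise_linear_with (ts n) (us n)" "locally_uniform_limit us u"
    using piecewise_linear_dense[OF u] by blast
  have lim: "(\<lambda>n. G (us n) w x) \<longlonglongrightarrow> G u w x" if "is_play_extension gl gr G" for G
  proof -
    have "locally_uniform_limit (\<lambda>n. G (us n) w) (G u w)"
      using that us u piecewise_linear_continuous[OF us(1)] tendsto_const[of w sequentially]
      unfolding is_play_extension_def by blast
    with x have "uniform_limit {0..x} (\<lambda>n. G (us n) w) (G u w) sequentially"
      by (simp add: locally_uniform_limit_def)
    then show ?thesis
      by (rule tendsto_uniform_limitI) (use x in auto)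
  qed
  \<comment> \<open>On the approximants both operators satisfy the same recursion, so they agree there.\<close>
  have rec: "play_recursion gl gr (ts n) (us n) w (G (us n) w)" if "is_play_extension gl gr G" for G n
    using that us(1)[of n] unfolding is_play_extension_def by (elim conjE) metis
  have "H (us n) w x = H' (us n) w x" for n
    by (rule play_recursion_unique[OF us(1) rec[OF H] rec[OF H'] x])
  with lim[OF H] have "(\<lambda>n. H' (us n) w x) \<longlonglongrightarrow> H u w x" by simp
  then show ?thesis using lim[OF H'] by (rule LIMSEQ_unique)
qed

context hysteresis_curves
begin

lemma gen_play_eq_play:
  assumes "continuous_on {0..} u" "0 \<le> t"
  shows "gen_play gl gr u w t = play gl gr u w t"
proof (rule is_play_extension_unique[OF _ play_is_play_extension assms])
  show "is_play_extension gl gr (gen_play gl gr)"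
    unfolding gen_play_def using play_is_play_extension by (rule someI[of "is_play_extension gl gr"])
qed

end

section \<open>Differential equations with a causal Lipschitz right-hand side\<close>

text \<open>
  An operator whose value at time \<open>t\<close> depends, in a Lipschitz manner, only on the restriction of
  its argument to \<open>[0,t]\<close>. Positivity of \<open>C\<close> is no restriction, as \<open>C\<close> may be enlarged.
\<close>

locale causal_lipschitz =
  fixes F :: "(real \<Rightarrow> real) \<Rightarrow> real \<Rightarrow> real" and C :: real
  assumes F_continuous: "continuous_on {0..} u \<Longrightarrow> continuous_on {0..} (F u)"
    and F_lipschitz: "\<lbrakk>continuous_on {0..} u; continuous_on {0..} v; 0 \<le> t;
        \<And>s. s \<in> {0..t} \<Longrightarrow> \<bar>u s - v s\<bar> \<le> d\<rbrakk> \<Longrightarrow> \<bar>F u t - F v t\<bar> \<le> C * d"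
    and C_pos: "0 < C"
begin

text \<open>
  The constant \<open>2 * C\<close> in the weight is chosen such that the derivative of
  \<open>A / 2 * exp (2 * C * t)\<close> is \<open>C * (A * exp (2 * C * t))\<close>, which bounds the derivative of
  \<open>U - V\<close>. Applied repeatedly, the lemma halves the distance of two solutions or of two
  successive Picard iterates.
\<close>

lemma weighted_contraction:
  assumes u: "continuous_on {0..} u" and v: "continuous_on {0..} v"
    and U: "\<And>t. 0 \<le> t \<Longrightarrow> (U has_real_derivative F u t) (at t within {0..})"
    and V: "\<And>t. 0 \<le> t \<Longrightarrow> (V has_real_derivative F v t) (at t within {0..})"
    and "U 0 = V 0"
    and bound: "\<And>t. t \<in> {0..T} \<Longrightarrow> \<bar>u t - v t\<bar> \<le> A * exp (2 * C * t)"
    and t: "t \<in> {0..T}"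
  shows "\<bar>U t - V t\<bar> \<le> A / 2 * exp (2 * C * t)"
proof -
  have A: "0 \<le> A" using bound[of 0] t by auto
  show ?thesis
  proof (cases "t = 0")
    case True
    with A \<open>U 0 = V 0\<close> show ?thesis by simp
  next
    case False
    have "norm ((U t - V t) - (U 0 - V 0)) \<le> A / 2 * exp (2 * C * t) - A / 2 * exp (2 * C * 0)"
    proof (rule differentiable_bound_general)
      show "0 < t" using False t by simp
      have "continuous_on {0..} U" "continuous_on {0..} V"
        using U V DERIV_continuous_on[of "{0..}"] by (metis atLeast_iff)+
      then show "continuous_on {0..t} (\<lambda>t. U t - V t)"
        by (intro continuous_on_diff) (auto intro: continuous_on_subset)
      show "continuous_on {0..t} (\<lambda>t. A / 2 * exp (2 * C * t))"
        by (intro continuous_intros)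
      fix x assume x: "0 < x" "x < t"
      have "at x within {0..} = at x" using x by (intro at_within_interior) auto
      then have "((\<lambda>t. U t - V t) has_real_derivative F u x - F v x) (at x)"
        using U[of x] V[of x] x by (auto intro: DERIV_diff)
      then show "((\<lambda>t. U t - V t) has_vector_derivative F u x - F v x) (at x)"
        by (simp add: has_real_derivative_iff_has_vector_derivative)
      show "((\<lambda>t. A / 2 * exp (2 * C * t)) has_vector_derivative C * (A * exp (2 * C * x))) (at x)"
        unfolding has_real_derivative_iff_has_vector_derivative[symmetric]
        by (auto intro!: derivative_eq_intros)
      show "norm (F u x - F v x) \<le> C * (A * exp (2 * C * x))"
        unfolding real_norm_def
      proof (rule F_lipschitz[OF u v])
        fix s assume s: "s \<in> {0..x}"
        have "\<bar>u s - v s\<bar> \<le> A * exp (2 * C * s)" using s x t by (intro bound) auto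
        also have "\<dots> \<le> A * exp (2 * C * x)" using s A C_pos by (intro mult_left_mono) auto
        finally show "\<bar>u s - v s\<bar> \<le> A * exp (2 * C * x)" .
      qed (use x in simp)
    qed
    with A \<open>U 0 = V 0\<close> show ?thesis by simp
  qed
qed

text \<open>
  The Picard operator, the right-hand side of the integral form of the problem \<open>u' = F u\<close>,
  \<open>u 0 = u0\<close>.
\<close>

definition picard :: "real \<Rightarrow> (real \<Rightarrow> real) \<Rightarrow> real \<Rightarrow> real" where
  "picard u0 u t = u0 + integral {0..t} (F u)"

lemma picard_at_0 [simp]: "picard u0 u 0 = u0"
  by (simp add: picard_def)

lemma picard_has_derivative:
  assumes "continuous_on {0..} u" "0 \<le> t"
  shows "(picard u0 u has_real_derivative F u t) (at t within {0..})"
proof -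
  have "((\<lambda>t. integral {0..t} (F u)) has_real_derivative F u t) (at t within {0..t + 1})"
    using assms by (intro integral_has_real_derivative continuous_on_subset[OF F_continuous]) auto
  moreover have "at t within {0..t + 1} = at t within {0..}"
    by (intro at_within_nhd[where S = "{..<t + 1}"]) auto
  ultimately show ?thesis
    unfolding picard_def by (auto intro!: derivative_eq_intros)
qed

lemma picard_continuous:
  assumes "continuous_on {0..} u"
  shows "continuous_on {0..} (picard u0 u)"
  using picard_has_derivative[OF assms] by (intro DERIV_continuous_on) auto

lemma causal_cauchy_unique:
  assumes u: "\<And>t. 0 \<le> t \<Longrightarrow> (u has_real_derivative F u t) (at t within {0..})"
    and v: "\<And>t. 0 \<le> t \<Longrightarrow> (v has_real_derivative F v t) (at t within {0..})"
    and "u 0 = v 0" and T: "0 \<le> T"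
  shows "u T = v T"
proof -
  have cu: "continuous_on {0..} u" and cv: "continuous_on {0..} v"
    using u v by (auto intro!: DERIV_continuous_on)
  have "continuous_on {0..T} (\<lambda>t. u t - v t)"
    by (intro continuous_on_diff continuous_on_subset[OF cu] continuous_on_subset[OF cv]) auto
  then obtain M where M: "\<And>t. t \<in> {0..T} \<Longrightarrow> \<bar>u t - v t\<bar> \<le> M"
    using continuous_on_Icc_bounded by blast
  have "\<bar>u t - v t\<bar> \<le> M / 2 ^ n * exp (2 * C * t)" if "t \<in> {0..T}" for n t
    using that
  proof (induction n arbitrary: t)
    case 0
    have "0 \<le> M" using M[OF 0] by linarith
    then have "M * 1 \<le> M * exp (2 * C * t)"
      using 0 C_pos by (intro mult_left_mono) auto
    with M[OF 0] show ?case by simp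
  next
    case (Suc n)
    show ?case
      using weighted_contraction[OF cu cv u v \<open>u 0 = v 0\<close> Suc.IH Suc.prems] by (simp add: mult.commute)
  qed
  then have "\<bar>u T - v T\<bar> \<le> (M * exp (2 * C * T)) * (1 / 2) ^ n" for n
    using T by (simp add: power_one_over)
  moreover have "(\<lambda>n. (M * exp (2 * C * T)) * (1 / 2) ^ n) \<longlonglongrightarrow> (M * exp (2 * C * T)) * 0"
    by (intro tendsto_mult tendsto_const LIMSEQ_realpow_zero) auto
  ultimately have "\<bar>u T - v T\<bar> \<le> 0"
    by (intro LIMSEQ_le_const[where X = "\<lambda>n. (M * exp (2 * C * T)) * (1 / 2) ^ n"]) auto
  then show ?thesis by simp
qed

lemma causal_cauchy_exists:
  "\<exists>u. (\<forall>t\<ge>0. (u has_real_derivative F u t) (at t within {0..})) \<and> u 0 = u0"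
proof -
  define x where "x n = (picard u0 ^^ n) (\<lambda>_. u0)" for n
  have x_Suc: "x (Suc n) = picard u0 (x n)" for n by (simp add: x_def)
  have x_cont: "continuous_on {0..} (x n)" for n
    by (induction n) (simp_all add: x_def picard_continuous)
  define f where "f n t = x (Suc n) t - x n t" for n t
  have sum_f: "(\<Sum>i<n. f i t) = x n t - u0" for n t
    unfolding f_def by (subst sum_lessThan_telescope) (simp add: x_def)
  \<comment> \<open>The limit of the iterates, as a telescoping series: this pointwise definition serves all intervals \<open>[0,T]\<close> at once.\<close>
  define u where "u t = u0 + (\<Sum>i. f i t)" for t
  have unif: "uniform_limit {0..T} x u sequentially" if T: "0 \<le> T" for T
  proof -
    have "continuous_on {0..T} (f 0)"
      unfolding f_def by (intro continuous_on_diff continuous_on_subset[OF x_cont]) auto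
    then obtain M where M: "\<And>t. t \<in> {0..T} \<Longrightarrow> \<bar>f 0 t\<bar> \<le> M"
      using continuous_on_Icc_bounded by blast
    have M0: "0 \<le> M" using M[of 0] T by auto
    have f_bound: "\<bar>f n t\<bar> \<le> M / 2 ^ n * exp (2 * C * t)" if "t \<in> {0..T}" for n t
      using that
    proof (induction n arbitrary: t)
      case 0
      have "M * 1 \<le> M * exp (2 * C * t)"
        using 0 C_pos M0 by (intro mult_left_mono) auto
      with M[OF 0] show ?case by simp
    next
      case (Suc n)
      have "\<bar>x (Suc (Suc n)) t - x (Suc n) t\<bar> \<le> M / 2 ^ n / 2 * exp (2 * C * t)"
      proof (rule weighted_contraction[OF x_cont x_cont _ _ _ _ Suc.prems])
        show "\<bar>x (Suc n) t - x n t\<bar> \<le> M / 2 ^ n * exp (2 * C * t)" if "t \<in> {0..T}" for t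
          using Suc.IH[OF that] by (simp add: f_def)
      qed (simp_all add: x_Suc picard_has_derivative picard_continuous x_cont)
      then show ?case by (simp add: f_def mult.commute)
    qed
    have "uniform_limit {0..T} (\<lambda>n t. \<Sum>i<n. f i t) (\<lambda>t. \<Sum>i. f i t) sequentially"
    proof (rule Weierstrass_m_test)
      fix n t assume t: "t \<in> {0..T}"
      have "M / 2 ^ n * exp (2 * C * t) \<le> M / 2 ^ n * exp (2 * C * T)"
        using t C_pos M0 by (intro mult_left_mono) auto
      with f_bound[OF t, of n] show "norm (f n t) \<le> (M * exp (2 * C * T)) * (1 / 2) ^ n"
        by (simp add: power_one_over)
    next
      show "summable (\<lambda>n. (M * exp (2 * C * T)) * (1 / 2) ^ n)"
        by (intro summable_mult summable_geometric) auto
    qed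
    then have "uniform_limit {0..T} (\<lambda>n t. u0 + (\<Sum>i<n. f i t)) u sequentially"
      unfolding u_def by (intro uniform_limit_intros)
    then show ?thesis by (simp add: sum_f)
  qed
  have u_cont: "continuous_on {0..} u"
  proof (rule continuous_on_atLeast_0I)
    fix T :: real assume "0 \<le> T"
    show "continuous_on {0..T} u"
      by (rule uniform_limit_theorem[OF _ unif[OF \<open>0 \<le> T\<close>]])
        (auto intro!: always_eventually continuous_on_subset[OF x_cont])
  qed
  have fixpoint: "picard u0 u t = u t" if t: "0 \<le> t" for t
  proof -
    have "(\<lambda>n. x (Suc n) t) \<longlonglongrightarrow> picard u0 u t"
    proof (rule tendstoI)
      fix e :: real assume e: "0 < e"
      \<comment> \<open>With this \<open>A\<close> the contraction bound at \<open>t\<close> becomes \<open>e / 2\<close>.\<close>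
      define A where "A = e / exp (2 * C * t)"
      have A: "0 < A" using e by (simp add: A_def)
      show "\<forall>\<^sub>F n in sequentially. dist (x (Suc n) t) (picard u0 u t) < e"
        using uniform_limitD[OF unif[OF t] A]
      proof eventually_elim
        case (elim n)
        have "\<bar>x (Suc n) t - picard u0 u t\<bar> \<le> A / 2 * exp (2 * C * t)"
        proof (rule weighted_contraction[OF x_cont u_cont])
          fix s assume s: "s \<in> {0..t}"
          have "\<bar>x n s - u s\<bar> \<le> A * 1" using elim s by (auto simp: dist_real_def less_imp_le)
          also have "\<dots> \<le> A * exp (2 * C * s)" using A s C_pos by (intro mult_left_mono) auto
          finally show "\<bar>x n s - u s\<bar> \<le> A * exp (2 * C * s)" .
        qed (use t in \<open>simp_all add: x_Suc picard_has_derivative x_cont u_cont\<close>)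
        with e show ?case by (simp add: A_def dist_real_def)
      qed
    qed
    moreover have "(\<lambda>n. x n t) \<longlonglongrightarrow> u t"
      by (rule tendsto_uniform_limitI[OF unif[OF t]]) (use t in auto)
    then have "(\<lambda>n. x (Suc n) t) \<longlonglongrightarrow> u t" by (rule LIMSEQ_Suc)
    ultimately show ?thesis by (rule LIMSEQ_unique)
  qed
  have "(u has_real_derivative F u t) (at t within {0..})" if "0 \<le> t" for t
    by (rule has_field_derivative_transform_within[OF picard_has_derivative[OF u_cont that] zero_less_one])
      (use that fixpoint in auto)
  moreover have "u 0 = u0" using fixpoint[of 0] by simp
  ultimately show ?thesis by blast
qed

end

section \<open>The Cauchy problem with hysteresis\<close>

theorem theorem4p2:
  fixes \<gamma>\<^sub>l \<gamma>\<^sub>r r :: "real \<Rightarrow> real" and u\<^sub>0 w\<^sub>0 K :: real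
  assumes "mono \<gamma>\<^sub>l" and "mono \<gamma>\<^sub>r"
    and "\<exists>L. L-lipschitz_on UNIV \<gamma>\<^sub>l" and "\<exists>L. L-lipschitz_on UNIV \<gamma>\<^sub>r"
    and "\<And>x. \<gamma>\<^sub>r x \<le> \<gamma>\<^sub>l x"
    and "\<exists>L. L-lipschitz_on {0..} r"
    and "\<gamma>\<^sub>r u\<^sub>0 \<le> w\<^sub>0" and "w\<^sub>0 \<le> \<gamma>\<^sub>l u\<^sub>0"
    and "K > 0"
  shows "(\<exists>u. play_cauchy_solution \<gamma>\<^sub>l \<gamma>\<^sub>r r K u\<^sub>0 w\<^sub>0 u) \<and>
         (\<forall>u v. play_cauchy_solution \<gamma>\<^sub>l \<gamma>\<^sub>r r K u\<^sub>0 w\<^sub>0 u \<longrightarrow>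
                play_cauchy_solution \<gamma>\<^sub>l \<gamma>\<^sub>r r K u\<^sub>0 w\<^sub>0 v \<longrightarrow> (\<forall>t\<ge>0. u t = v t))"
proof -
  obtain Ll Lr where Ll: "Ll-lipschitz_on UNIV \<gamma>\<^sub>l" and Lr: "Lr-lipschitz_on UNIV \<gamma>\<^sub>r"
    using assms(3,4) by blast
  interpret hysteresis_curves \<gamma>\<^sub>l \<gamma>\<^sub>r
    using assms Ll Lr by unfold_locales (auto intro: lipschitz_on_continuous_on)
  have r: "continuous_on {0..} r" using assms(6) lipschitz_on_continuous_on by blast
  \<comment> \<open>The maximum with \<open>1\<close> ensures that the Lipschitz constant of the right-hand side is positive.\<close>
  define L where "L = max 1 (max Ll Lr)"
  define F where "F u t = K * (r t - play \<gamma>\<^sub>l \<gamma>\<^sub>r u w\<^sub>0 t)" for u t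
  interpret causal_lipschitz F "K * L"
  proof
    show "0 < K * L" using \<open>K > 0\<close> by (simp add: L_def)
    show "continuous_on {0..} (F u)" if "continuous_on {0..} u" for u
      unfolding F_def by (intro continuous_intros r play_continuous that)
    fix u v :: "real \<Rightarrow> real" and t d :: real
    assume u: "continuous_on {0..} u" and v: "continuous_on {0..} v" and t: "0 \<le> t"
      and d: "\<And>s. s \<in> {0..t} \<Longrightarrow> \<bar>u s - v s\<bar> \<le> d"
    have d0: "0 \<le> d" using d[of 0] t by auto
    have lip: "\<bar>g (u s) - g (v s)\<bar> \<le> L * d"
      if "s \<in> {0..t}" "M-lipschitz_on UNIV g" "M \<le> L" for s g M
    proof -
      have "\<bar>g (u s) - g (v s)\<bar> \<le> M * \<bar>u s - v s\<bar>"
        using lipschitz_onD[OF that(2), of "u s" "v s"] by (simp add: dist_real_def)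
      also have "\<dots> \<le> L * d"
        using that d[OF that(1)] lipschitz_on_nonneg[OF that(2)] by (intro mult_mono) auto
      finally show ?thesis .
    qed
    have "\<bar>play \<gamma>\<^sub>l \<gamma>\<^sub>r u w\<^sub>0 t - play \<gamma>\<^sub>l \<gamma>\<^sub>r v w\<^sub>0 t\<bar> \<le> L * d"
      using lip[OF _ Ll] lip[OF _ Lr] d0 by (intro play_dist_le[OF u v t]) (auto simp: L_def)
    moreover have "\<bar>F u t - F v t\<bar> = K * \<bar>play \<gamma>\<^sub>l \<gamma>\<^sub>r u w\<^sub>0 t - play \<gamma>\<^sub>l \<gamma>\<^sub>r v w\<^sub>0 t\<bar>"
      using \<open>K > 0\<close> by (simp add: F_def abs_mult abs_minus_commute flip: right_diff_distrib)
    ultimately show "\<bar>F u t - F v t\<bar> \<le> K * L * d"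
      using \<open>K > 0\<close> by simp
  qed
  \<comment> \<open>A solution is differentiable and hence continuous, so its hysteresis term is given by the closed form.\<close>
  have solution_iff: "play_cauchy_solution \<gamma>\<^sub>l \<gamma>\<^sub>r r K u\<^sub>0 w\<^sub>0 u \<longleftrightarrow>
      (\<forall>t\<ge>0. (u has_real_derivative F u t) (at t within {0..})) \<and> u 0 = u\<^sub>0" for u
  proof (cases "continuous_on {0..} u")
    case True
    have "(1 / K) * u' + gen_play \<gamma>\<^sub>l \<gamma>\<^sub>r u w\<^sub>0 t = r t \<longleftrightarrow> u' = F u t" if "0 \<le> t" for u' t
      using \<open>K > 0\<close> gen_play_eq_play[OF True that] by (auto simp: F_def field_simps)
    moreover have "gen_play \<gamma>\<^sub>l \<gamma>\<^sub>r u w\<^sub>0 0 = w\<^sub>0" if "u 0 = u\<^sub>0"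
      using gen_play_eq_play[OF True, of 0] assms(7,8) that
      by (simp add: play_at_0 play_clip_def)
    ultimately show ?thesis unfolding play_cauchy_solution_def by auto
  next
    case False
    then show ?thesis
      unfolding play_cauchy_solution_def by (metis DERIV_continuous_on atLeast_iff)
  qed
  show ?thesis
    unfolding solution_iff using causal_cauchy_exists[of u\<^sub>0] causal_cauchy_unique by auto
qed

end
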